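(* Let $G=(V=[n],E,(p_{uv})_{(u,v)\in E})$ be an influence graph and let $k\in\{2,\dots,n\}$. Let $S_0:=\emptyset$ and for $t=1,\dots,k$ let $S_t:=S_{t-1}\cup\{v_t\}$, where $v_t\in V\setminus S_{t-1}$ maximizes $\sigma(S_{t-1}\cup\{v\})$ over $v\in V\setminus S_{t-1}$ (the non-adaptive greedy algorithm, with $\sigma$ evaluated exactly). Then $$\sigma(S_k)\ \ge\ \frac12\left(1-\left(1-\frac1k\right)^k\right)OPT_A(G,k)\ \ge\ \frac12\left(1-\frac1e\right)OPT_A(G,k).$$
   Context: Independent cascade model: $G$ is a directed graph on $V=[n]$ with an activation probability $p_{uv}\in[0,1]$ on each edge. The live-edge graph $\mathbf L\subseteq E$ is random, containing each edge $(u,v)$ independently with probability $p_{uv}$. For $L\subseteq E$ and $S\subseteq V$, $R_L(S)$ is the set of nodes $v$ such that some $u\in S$ has a directed path (possibly of length $0$) to $v$ using edges of $L$; $\sigma_L(S):=|R_L(S)|$ and $\sigma(S):=\mathbb{E}_{\mathbf L}[\sigma_{\mathbf L}(S)]$. Myopic feedback: for $L\subseteq E$ the realisation $\phi_L:V\to2^V$ is $\phi_L(v)=\{v\}\cup\{z:(v,z)\in L\}$; the random realisation is $\Phi:=\phi_{\mathbf L}$. A partial realisation $\psi$ is the restriction of some $\phi_L$ to a set $dom(\psi)\subseteq V$. An adaptive policy $\pi$ maps partial realisations to a node of $V$ or to STOP; it is run by starting from $\psi=\emptyset$ and, while $\pi(\psi)=v\neq$ STOP, setting $\psi\leftarrow\psi\cup\{(v,\Phi(v))\}$;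 the final partial realisation is $\Psi_\pi$. Its expected influence spread is $\sigma(\pi):=\mathbb{E}_{\mathbf L}[\sigma_{\mathbf L}(dom(\Psi_\pi))]$, and $|\pi|=k$ means $|dom(\Psi_\pi)|=k$ always. $OPT_A(G,k)$ is the maximum of $\sigma(\pi)$ over adaptive policies with $|\pi|=k$. *)

theory Defs
  imports Complex_Main
begin

definition influence_graph :: "nat \<Rightarrow> (nat \<times> nat) set \<Rightarrow> (nat \<times> nat \<Rightarrow> real) \<Rightarrow> bool" where
  "influence_graph n E p \<longleftrightarrow> E \<subseteq> {1..n} \<times> {1..n} \<and> (\<forall>e\<in>E. 0 \<le> p e \<and> p e \<le> 1)"

definition live_prob :: "(nat \<times> nat) set \<Rightarrow> (nat \<times> nat \<Rightarrow> real) \<Rightarrow> (nat \<times> nat) set \<Rightarrow> real" where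
  "live_prob E p L = (\<Prod>e\<in>L. p e) * (\<Prod>e\<in>E - L. 1 - p e)"

definition reach :: "(nat \<times> nat) set \<Rightarrow> nat set \<Rightarrow> nat set" where
  "reach L S = {v. \<exists>u\<in>S. (u, v) \<in> L\<^sup>*}"

definition sigma_L :: "(nat \<times> nat) set \<Rightarrow> nat set \<Rightarrow> nat" where
  "sigma_L L S = card (reach L S)"

definition sigma :: "(nat \<times> nat) set \<Rightarrow> (nat \<times> nat \<Rightarrow> real) \<Rightarrow> nat set \<Rightarrow> real" where
  "sigma E p S = (\<Sum>L\<in>Pow E. live_prob E p L * real (sigma_L L S))"

(* myopic feedback: phi_L(v) = {v} \<union> out-neighbours of v in L *)
definition realisation :: "(nat \<times> nat) set \<Rightarrow> nat \<Rightarrow> nat set" where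
  "realisation L v = insert v {z. (v, z) \<in> L}"

(* partial realisations are partial maps; a policy returns Some v or None (= STOP) *)
type_synonym partial_real = "nat \<Rightarrow> nat set option"
type_synonym policy = "partial_real \<Rightarrow> nat option"

fun run :: "policy \<Rightarrow> (nat \<times> nat) set \<Rightarrow> nat \<Rightarrow> partial_real" where
  "run \<pi> L 0 = Map.empty"
| "run \<pi> L (Suc m) = (case \<pi> (run \<pi> L m) of
      None \<Rightarrow> run \<pi> L m
    | Some v \<Rightarrow> (run \<pi> L m)(v \<mapsto> realisation L v))"

definition stops :: "policy \<Rightarrow> (nat \<times> nat) set \<Rightarrow> bool" where
  "stops \<pi> L \<longleftrightarrow> (\<exists>m. \<pi> (run \<pi> L m) = None)"

definition final :: "policy \<Rightarrow> (nat \<times> nat) set \<Rightarrow> partial_real" where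
  "final \<pi> L = run \<pi> L (LEAST m. \<pi> (run \<pi> L m) = None)"

definition policy_size :: "nat set \<Rightarrow> (nat \<times> nat) set \<Rightarrow> policy \<Rightarrow> nat \<Rightarrow> bool" where
  "policy_size V E \<pi> k \<longleftrightarrow>
     (\<forall>L. L \<subseteq> E \<longrightarrow> stops \<pi> L \<and> dom (final \<pi> L) \<subseteq> V \<and> card (dom (final \<pi> L)) = k)"

definition sigma_pol :: "(nat \<times> nat) set \<Rightarrow> (nat \<times> nat \<Rightarrow> real) \<Rightarrow> policy \<Rightarrow> real" where
  "sigma_pol E p \<pi> = (\<Sum>L\<in>Pow E. live_prob E p L * real (sigma_L L (dom (final \<pi> L))))"

definition OPT_A :: "nat \<Rightarrow> (nat \<times> nat) set \<Rightarrow> (nat \<times> nat \<Rightarrow> real) \<Rightarrow> nat \<Rightarrow> real" where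
  "OPT_A n E p k = Sup {sigma_pol E p \<pi> | \<pi>. policy_size {1..n} E \<pi> k}"

(* v 1, ..., v k is a run of the exact non-adaptive greedy algorithm; S_t = v ` {1..t} *)
definition greedy_seq :: "nat \<Rightarrow> (nat \<times> nat) set \<Rightarrow> (nat \<times> nat \<Rightarrow> real) \<Rightarrow> nat \<Rightarrow> (nat \<Rightarrow> nat) \<Rightarrow> bool" where
  "greedy_seq n E p k v \<longleftrightarrow>
     (\<forall>t\<in>{1..k}. v t \<in> {1..n} - v ` {1..<t} \<and>
        (\<forall>w\<in>{1..n} - v ` {1..<t}.
           sigma E p (insert w (v ` {1..<t})) \<le> sigma E p (insert (v t) (v ` {1..<t}))))"

end

theory Submission
  imports Defs
begin

text \<open>It suffices to show, for every node set \<open>S\<close> and every policy \<open>\<pi>\<close> with \<open>|\<pi>| = k\<close>, that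
  \<open>\<sigma>(\<pi>) \<le> 2 (\<sigma>(S) + k \<Delta>)\<close>, where \<open>\<Delta>\<close> is the largest marginal gain over \<open>S\<close>: with \<open>S = S\<^sub>t\<close> this is the
  usual greedy recursion for \<open>OPT/2 - \<sigma>(S\<^sub>t)\<close>. The bound holds separately for each target node \<open>w\<close>:
  the probability that the seeds of \<open>\<pi>\<close> reach \<open>w\<close> is at most \<open>2 P(S\<close> reaches \<open>w)\<close> plus twice the
  expected sum of the marginal gains \<open>q(v) = P(v\<close> reaches \<open>w\<close>, \<open>S\<close> does not\<open>)\<close> of the seeds \<open>v\<close>.
  Suppose \<open>\<pi>\<close> has observed the out-edges \<open>x\<close> of the seeds \<open>A\<close>. For a sample \<open>L\<close> of the other edges let
  \<open>g\<close> say whether \<open>A\<close> reaches \<open>w\<close> in \<open>L \<union> x\<close>, and let \<open>\<zeta>\<close> be the probability that \<open>S\<close> reaches \<open>w\<close> when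
  the out-edges of \<open>A\<close> are drawn afresh. For a suitable pair of convex functions \<open>u\<^sub>0, u\<^sub>1\<close> the
  potential \<open>E\<^sub>L u\<^sub>g(\<zeta>)\<close> starts at \<open>2 P(S\<close> reaches \<open>w)\<close>, dominates the probability that \<open>A\<close> reaches
  \<open>w\<close>, and increases on average by at most \<open>2 q(v)\<close> when \<open>v\<close> is seeded.\<close>

section \<open>Expectations over live-edge graphs\<close>

definition live_expect ::
  "(nat \<times> nat) set \<Rightarrow> (nat \<times> nat \<Rightarrow> real) \<Rightarrow> ((nat \<times> nat) set \<Rightarrow> real) \<Rightarrow> real" where
  "live_expect F p f = (\<Sum>L\<in>Pow F. live_prob F p L * f L)"

lemma live_prob_nonneg:
  assumes "\<forall>e\<in>F. 0 \<le> p e \<and> p e \<le> 1" "L \<subseteq> F"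
  shows "0 \<le> live_prob F p L"
  unfolding live_prob_def using assms by (intro mult_nonneg_nonneg prod_nonneg) auto

lemma live_expect_const:
  assumes "finite F"
  shows "live_expect F p (\<lambda>_. c) = c"
proof -
  have "(\<Sum>L\<in>Pow F. live_prob F p L) = (\<Prod>e\<in>F. p e + (1 - p e))"
    unfolding live_prob_def by (rule prod_add[OF assms, symmetric])
  then show ?thesis
    by (simp add: live_expect_def flip: sum_distrib_right)
qed

lemma live_expect_cong:
  assumes "\<And>L. L \<subseteq> F \<Longrightarrow> f L = g L"
  shows "live_expect F p f = live_expect F p g"
  unfolding live_expect_def using assms by (intro sum.cong) auto

lemma live_expect_mono:
  assumes "\<forall>e\<in>F. 0 \<le> p e \<and> p e \<le> 1" "\<And>L. L \<subseteq> F \<Longrightarrow> f L \<le> g L"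
  shows "live_expect F p f \<le> live_expect F p g"
  unfolding live_expect_def using assms
  by (intro sum_mono mult_left_mono live_prob_nonneg) auto

lemma live_expect_add:
  "live_expect F p (\<lambda>L. f L + g L) = live_expect F p f + live_expect F p g"
  by (simp add: live_expect_def distrib_left sum.distrib)

lemma live_expect_diff:
  "live_expect F p (\<lambda>L. f L - g L) = live_expect F p f - live_expect F p g"
  by (simp add: live_expect_def right_diff_distrib sum_subtractf)

lemma live_expect_cmult:
  "live_expect F p (\<lambda>L. c * f L) = c * live_expect F p f"
  by (simp add: live_expect_def sum_distrib_left mult.left_commute)

lemma live_expect_sum:
  "live_expect F p (\<lambda>L. \<Sum>i\<in>I. f i L) = (\<Sum>i\<in>I. live_expect F p (f i))"
  unfolding live_expect_def sum_distrib_left by (rule sum.swap)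

lemma live_expect_swap:
  "live_expect F p (\<lambda>L. live_expect G p (f L)) = live_expect G p (\<lambda>K. live_expect F p (\<lambda>L. f L K))"
  unfolding live_expect_def sum_distrib_left by (subst sum.swap) (simp add: mult.left_commute)

text \<open>Independence: on disjoint edge sets the weights multiply, and a subset of the union is
  the same as a pair of subsets.\<close>

lemma live_expect_union:
  assumes "finite F" "finite G" "F \<inter> G = {}"
  shows "live_expect (F \<union> G) p f = live_expect F p (\<lambda>L. live_expect G p (\<lambda>K. f (L \<union> K)))"
proof -
  have prob: "live_prob (F \<union> G) p (L \<union> K) = live_prob F p L * live_prob G p K"
    if "L \<subseteq> F" "K \<subseteq> G" for L K
  proof -
    have "F \<union> G - (L \<union> K) = (F - L) \<union> (G - K)"
      using that assms(3) by blast
    moreover have "prod p (L \<union> K) = prod p L * prod p K"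
      using that assms by (intro prod.union_disjoint) (auto intro: finite_subset)
    moreover have "(\<Prod>e\<in>(F - L) \<union> (G - K). 1 - p e) = (\<Prod>e\<in>F - L. 1 - p e) * (\<Prod>e\<in>G - K. 1 - p e)"
      using assms by (intro prod.union_disjoint) auto
    ultimately show ?thesis
      by (simp add: live_prob_def)
  qed
  have "live_expect F p (\<lambda>L. live_expect G p (\<lambda>K. f (L \<union> K)))
      = (\<Sum>L\<in>Pow F. \<Sum>K\<in>Pow G. live_prob (F \<union> G) p (L \<union> K) * f (L \<union> K))"
    unfolding live_expect_def sum_distrib_left
    by (intro sum.cong) (auto simp: prob)
  also have "\<dots> = (\<Sum>(L, K)\<in>Pow F \<times> Pow G. live_prob (F \<union> G) p (L \<union> K) * f (L \<union> K))"
    by (rule sum.cartesian_product)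
  also have "\<dots> = live_expect (F \<union> G) p f"
    unfolding live_expect_def
    by (rule sum.reindex_bij_witness[where i = "\<lambda>M. (M \<inter> F, M \<inter> G)" and j = "\<lambda>(L, K). L \<union> K"])
      (use assms(3) in \<open>auto simp flip: Int_Un_distrib\<close>)
  finally show ?thesis ..
qed

lemma sigma_eq_live_expect: "sigma E p S = live_expect E p (\<lambda>L. real (sigma_L L S))"
  by (simp add: sigma_def live_expect_def)

lemma sigma_pol_eq_live_expect:
  "sigma_pol E p \<pi> = live_expect E p (\<lambda>L. real (sigma_L L (dom (final \<pi> L))))"
  by (simp add: sigma_pol_def live_expect_def)


section \<open>Reachability\<close>

lemma reach_mono: "L \<subseteq> K \<Longrightarrow> S \<subseteq> T \<Longrightarrow> reach L S \<subseteq> reach K T"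
  unfolding reach_def using rtrancl_mono by blast

lemma reach_insert: "reach L (insert v S) = reach L {v} \<union> reach L S"
  by (auto simp: reach_def)

lemma reach_step: "y \<in> reach L S \<Longrightarrow> (y, z) \<in> L \<Longrightarrow> z \<in> reach L S"
  unfolding reach_def by (auto intro: rtrancl_into_rtrancl)

lemma reach_base: "S \<subseteq> reach L S"
  by (auto simp: reach_def)

lemma reach_subset_vertices:
  assumes "L \<subseteq> V \<times> V" "S \<subseteq> V"
  shows "reach L S \<subseteq> V"
proof
  fix z assume "z \<in> reach L S"
  then obtain u where "u \<in> S" "(u, z) \<in> L\<^sup>*" by (auto simp: reach_def)
  from this(2,1) show "z \<in> V"
    by induction (use assms in auto)
qed

text \<open>Cut a path to \<open>w\<close> at its last edge from \<open>x\<close> or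
  \<open>y\<close>: from there on it starts in \<open>A\<close> or at \<open>v\<close> and continues
  in \<open>L\<close>. The induction restarts at each such edge.\<close>

lemma reach_through_last_seed:
  assumes "w \<in> reach (L \<union> (x \<union> y)) (insert v A)"
    and "\<And>e. e \<in> x \<Longrightarrow> fst e \<in> A" and "\<And>e. e \<in> y \<Longrightarrow> fst e = v"
  shows "w \<in> reach (L \<union> x) A \<or> w \<in> reach (L \<union> y) {v}"
proof -
  obtain u where "u \<in> insert v A" "(u, w) \<in> (L \<union> (x \<union> y))\<^sup>*"
    using assms(1) by (auto simp: reach_def)
  from this(2,1) show ?thesis
  proof induction
    case base
    then show ?case using reach_base by fast
  next
    case (step a b)
    from step.hyps(2) consider "(a, b) \<in> L" | "(a, b) \<in> x" | "(a, b) \<in> y" by blast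
    then show ?case
    proof cases
      case 1
      then show ?thesis using step.IH[OF step.prems] reach_step by (meson UnI1)
    next
      case 2
      then have "a \<in> reach (L \<union> x) A" using assms(2) reach_base by fastforce
      then show ?thesis using 2 reach_step by (meson UnI2)
    next
      case 3
      then have "a \<in> reach (L \<union> y) {v}" using assms(3) reach_base by fastforce
      then show ?thesis using 3 reach_step by (meson UnI2)
    qed
  qed
qed

section \<open>A potential for one target node\<close>

text \<open>\<open>weight False 1 = 2\<close> is the factor \<open>2\<close> in front of the spread of \<open>S\<close>. Given \<open>weight False\<close>, the value
  \<open>weight True (1/2) = 1\<close> is forced: it is the lower bound of \<open>weight_ge\<close> and the upper bound of
  \<open>weight_hit\<close> for \<open>z = 1/2\<close>, \<open>y = 1\<close>, \<open>\<not> b\<close>.\<close>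

definition weight :: "bool \<Rightarrow> real \<Rightarrow> real" where
  "weight b z = (if b then 1 + (max 0 (2 * z - 1))\<^sup>2 else 2 * z\<^sup>2)"

lemma weight_ge: "of_bool b \<le> weight b z"
  by (simp add: weight_def)

text \<open>Both branches of \<open>weight\<close> are convex; the slopes are their derivatives at
  \<open>z\<close>.\<close>

lemma weight_tangent:
  "weight False z + 4 * z * (y - z) \<le> weight False y"
  "weight True z + 4 * max 0 (2 * z - 1) * (y - z) \<le> weight True y"
proof -
  have "0 \<le> 2 * (y - z)\<^sup>2" by simp
  then show "weight False z + 4 * z * (y - z) \<le> weight False y"
    by (simp add: weight_def power2_eq_square algebra_simps)
  define a b where "a = max 0 (2 * z - 1)" and "b = max 0 (2 * y - 1)"
  have "a * (2 * y - 1) \<le> a * b"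
    by (rule mult_left_mono) (auto simp: a_def b_def)
  moreover have "a * (2 * z - 1) = a * a"
    by (auto simp: a_def max_def)
  moreover have "0 \<le> (a - b)\<^sup>2" by simp
  ultimately show "weight True z + 4 * max 0 (2 * z - 1) * (y - z) \<le> weight True y"
    unfolding weight_def a_def[symmetric] b_def[symmetric]
    by (simp add: power2_eq_square algebra_simps)
qed

text \<open>For a hit that depends on the edges of \<open>v\<close>, the slope has to stay that of
  the \<open>False\<close> branch, since one slope must serve all outcomes of these edges. The
  marginal gain of \<open>v\<close> pays for \<open>2 * (1 - y)\<close>.\<close>

lemma weight_hit:
  assumes "0 \<le> z" "z \<le> 1" "0 \<le> y" "y \<le> 1"
  shows "weight True z + 4 * z * (y - z) \<le> weight b y + 2 * (1 - y)"
proof (cases b)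
  case False
  \<comment> \<open>Solving the claim for this square leaves a sum of two squares on the right; both
    vanish at \<open>z = 1/2\<close>, \<open>y = 1\<close>.\<close>
  have "(max 0 (2 * z - 1))\<^sup>2 \<le> 2 * (z - 1/2)\<^sup>2 + 2 * (z + 1/2 - y)\<^sup>2"
  proof (cases "z \<le> 1/2")
    case False
    then have "(z - 1/2)\<^sup>2 \<le> (z + 1/2 - y)\<^sup>2"
      using assms by (intro power_mono) auto
    with False show ?thesis by (simp add: max_def power2_eq_square algebra_simps)
  next
    case True
    then have "max 0 (2 * z - 1) = 0" by simp
    then show ?thesis by simp
  qed
  with False show ?thesis
    by (simp add: weight_def power2_eq_square algebra_simps)
next
  case True
  have "(max 0 (2 * z - 1))\<^sup>2 + 4 * z * (y - z) \<le> (max 0 (2 * y - 1))\<^sup>2 + 2 * (1 - y)"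
  proof (cases "z \<le> 1/2")
    case z: True
    have "4 * z * (y - z) \<le> y\<^sup>2"
      using zero_le_power2[of "2 * z - y"] by (simp add: power2_eq_square algebra_simps)
    moreover have "y\<^sup>2 \<le> (max 0 (2 * y - 1))\<^sup>2 + 2 * (1 - y)"
    proof (cases "y \<le> 1/2")
      case True
      then have "y\<^sup>2 \<le> 1" using assms by (simp add: power_le_one)
      moreover have "max 0 (2 * y - 1) = 0" using True by simp
      ultimately show ?thesis using True by simp
    next
      case False
      then show ?thesis
        using zero_le_power2[of "1 - y"] by (simp add: max_def power2_eq_square algebra_simps)
    qed
    moreover have "max 0 (2 * z - 1) = 0" using z by simp
    ultimately show ?thesis by simp
  next
    case z: False
    have *: "(2 * z - 1)\<^sup>2 + 4 * z * (y - z) = 1 - 4 * z * (1 - y)"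
      by (simp add: power2_eq_square algebra_simps)
    have "2 * (1 - y) \<le> 4 * z * (1 - y)"
      using z assms by (intro mult_right_mono) auto
    moreover have "2 * y - 1 \<le> (max 0 (2 * y - 1))\<^sup>2 + 2 * (1 - y)"
    proof (cases "y \<le> 1/2")
      case False
      then show ?thesis
        using zero_le_power2[of "1 - y"] by (simp add: max_def power2_eq_square algebra_simps)
    next
      case True
      then have "max 0 (2 * y - 1) = 0" by simp
      then show ?thesis using True by simp
    qed
    ultimately show ?thesis using z * by (simp add: max_def)
  qed
  with True show ?thesis by (simp add: weight_def)
qed

section \<open>Redrawing the out-edges of the observed seeds\<close>

definition out_edges :: "(nat \<times> nat) set \<Rightarrow> nat set \<Rightarrow> (nat \<times> nat) set" where
  "out_edges E A = {e \<in> E. fst e \<in> A}"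

lemma out_edges_empty [simp]: "out_edges E {} = {}"
  by (simp add: out_edges_def)

locale cascade =
  fixes E :: "(nat \<times> nat) set" and p :: "nat \<times> nat \<Rightarrow> real"
  assumes finite_edges: "finite E"
    and prob_edges: "\<forall>e\<in>E. 0 \<le> p e \<and> p e \<le> 1"
begin

abbreviation out :: "nat set \<Rightarrow> (nat \<times> nat) set" where
  "out \<equiv> out_edges E"

lemma finite_out [simp]: "finite (out A)" and finite_off [simp]: "finite (E - out A)"
  using finite_edges by (auto simp: out_edges_def)

lemma prob_out: "\<forall>e\<in>out A. 0 \<le> p e \<and> p e \<le> 1"
  and prob_off: "\<forall>e\<in>E - out A. 0 \<le> p e \<and> p e \<le> 1"
  using prob_edges by (auto simp: out_edges_def)

text \<open>This is \<open>\<zeta>\<close>. It averages over the out-edges of \<open>A\<close>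
  instead of using their observed state, so in \<open>potential\<close> it is linked to the flag
  only through \<open>L\<close>.\<close>

definition late_hit :: "nat set \<Rightarrow> nat \<Rightarrow> nat set \<Rightarrow> (nat \<times> nat) set \<Rightarrow> real" where
  "late_hit S w A L = live_expect (out A) p (\<lambda>Y. of_bool (w \<in> reach (L \<union> Y) S))"

definition potential :: "nat set \<Rightarrow> nat \<Rightarrow> nat set \<Rightarrow> (nat \<times> nat) set \<Rightarrow> real" where
  "potential S w A x =
     live_expect (E - out A) p (\<lambda>L. weight (w \<in> reach (L \<union> x) A) (late_hit S w A L))"

definition target_gain :: "nat set \<Rightarrow> nat \<Rightarrow> nat \<Rightarrow> real" where
  "target_gain S w v =
     live_expect E p (\<lambda>N. of_bool (w \<in> reach N (insert v S)) - of_bool (w \<in> reach N S))"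

lemma late_hit_bounds: "0 \<le> late_hit S w A L" "late_hit S w A L \<le> 1"
proof -
  have "live_expect (out A) p (\<lambda>_. 0) \<le> late_hit S w A L"
    "late_hit S w A L \<le> live_expect (out A) p (\<lambda>_. 1)"
    unfolding late_hit_def by (intro live_expect_mono prob_out; simp)+
  then show "0 \<le> late_hit S w A L" "late_hit S w A L \<le> 1"
    by (simp_all add: live_expect_const)
qed

lemma out_insert: "out (insert v A) = out {v} \<union> out A"
  by (auto simp: out_edges_def)

lemma off_split:
  assumes "v \<notin> A"
  shows "E - out A = (E - out (insert v A)) \<union> out {v}" "(E - out (insert v A)) \<inter> out {v} = {}"
  using assms by (auto simp: out_edges_def)

lemma live_expect_off:
  assumes "v \<notin> A"
  shows "live_expect (E - out A) p f =
    live_expect (E - out (insert v A)) p (\<lambda>L. live_expect (out {v}) p (\<lambda>y. f (L \<union> y)))"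
  unfolding off_split(1)[OF assms] by (intro live_expect_union off_split(2) assms; simp)

lemma live_expect_split:
  "live_expect E p f = live_expect (E - out A) p (\<lambda>L. live_expect (out A) p (\<lambda>Y. f (L \<union> Y)))"
proof -
  have "(E - out A) \<union> out A = E" "(E - out A) \<inter> out A = {}" by (auto simp: out_edges_def)
  then show ?thesis
    using live_expect_union[of "E - out A" "out A" p f] by simp
qed

text \<open>Tower property: redrawing the edges of \<open>v\<close> too averages the old value over
  them. This centres the linear terms in \<open>potential_step\<close>.\<close>

lemma late_hit_insert:
  assumes "v \<notin> A"
  shows "late_hit S w (insert v A) L = live_expect (out {v}) p (\<lambda>y. late_hit S w A (L \<union> y))"
proof -
  have "out {v} \<inter> out A = {}" using assms by (auto simp: out_edges_def)
  then show ?thesis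
    unfolding late_hit_def out_insert[of v A] by (subst live_expect_union) (simp_all add: Un_assoc)
qed

text \<open>A path from \<open>v\<close> inside \<open>L\<close> survives every redraw
  \<open>Y\<close> of the out-edges of \<open>A\<close>, so given \<open>L\<close> the gain is at
  least the chance that \<open>S\<close> misses \<open>w\<close>. Paths from \<open>v\<close> that
  use \<open>Y\<close> can only add to it.\<close>

lemma target_gain_ge:
  "live_expect (E - out A) p (\<lambda>L. of_bool (w \<in> reach L {v}) * (1 - late_hit S w A L))
     \<le> target_gain S w v"
proof -
  have "of_bool (w \<in> reach L {v}) * (1 - late_hit S w A L)
      \<le> live_expect (out A) p (\<lambda>Y. of_bool (w \<in> reach (L \<union> Y) (insert v S)) -
          of_bool (w \<in> reach (L \<union> Y) S))" for L
  proof -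
    have "1 - late_hit S w A L = live_expect (out A) p (\<lambda>Y. 1 - of_bool (w \<in> reach (L \<union> Y) S))"
      by (simp add: late_hit_def live_expect_diff live_expect_const)
    then have "of_bool (w \<in> reach L {v}) * (1 - late_hit S w A L) = live_expect (out A) p
        (\<lambda>Y. of_bool (w \<in> reach L {v}) * (1 - of_bool (w \<in> reach (L \<union> Y) S)))"
      by (simp only: live_expect_cmult)
    also have "\<dots> \<le> live_expect (out A) p (\<lambda>Y. of_bool (w \<in> reach (L \<union> Y) (insert v S)) -
          of_bool (w \<in> reach (L \<union> Y) S))"
    proof (intro live_expect_mono prob_out)
      fix Y
      have "w \<in> reach (L \<union> Y) {v}" if "w \<in> reach L {v}"
        using that reach_mono[of L "L \<union> Y" "{v}" "{v}"] by blast
      then show "of_bool (w \<in> reach L {v}) * (1 - of_bool (w \<in> reach (L \<union> Y) S))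
          \<le> (of_bool (w \<in> reach (L \<union> Y) (insert v S)) - of_bool (w \<in> reach (L \<union> Y) S) :: real)"
        by (auto simp: reach_insert[of _ v S])
    qed
    finally show ?thesis .
  qed
  then show ?thesis
    unfolding target_gain_def live_expect_split[of _ A]
    by (intro live_expect_mono prob_off)
qed

text \<open>Averaging over the edges \<open>y\<close> of \<open>v\<close> kills the linear term \<open>c * (late_hit S w A (L \<union> y) - z)\<close>,
  so the two sides are compared one \<open>y\<close> at a time against a tangent line.\<close>

lemma potential_step:
  assumes v: "v \<notin> A" and x: "x \<subseteq> out A"
  shows "live_expect (out {v}) p (\<lambda>X. potential S w (insert v A) (x \<union> X))
    \<le> potential S w A x + 2 * target_gain S w v"
proof -
  let ?F = "E - out (insert v A)" and ?h = "late_hit S w A"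
  have key: "live_expect (out {v}) p (\<lambda>y. weight (w \<in> reach (L \<union> (x \<union> y)) (insert v A))
        (late_hit S w (insert v A) L))
      \<le> live_expect (out {v}) p (\<lambda>y. weight (w \<in> reach (L \<union> y \<union> x) A) (?h (L \<union> y)) +
        2 * (of_bool (w \<in> reach (L \<union> y) {v}) * (1 - ?h (L \<union> y))))" for L
  proof -
    define z where "z = late_hit S w (insert v A) L"
    have z: "0 \<le> z" "z \<le> 1" unfolding z_def by (rule late_hit_bounds)+
    \<comment> \<open>The slope \<open>c\<close> may depend on \<open>L\<close> but not on
      \<open>y\<close>; hence the split on whether \<open>A\<close> reaches \<open>w\<close> without
      the edges of \<open>v\<close>.\<close>
    have "\<exists>c. \<forall>y\<subseteq>out {v}. weight (w \<in> reach (L \<union> (x \<union> y)) (insert v A)) z + c * (?h (L \<union> y) - z)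
      \<le> weight (w \<in> reach (L \<union> y \<union> x) A) (?h (L \<union> y)) +
        2 * (of_bool (w \<in> reach (L \<union> y) {v}) * (1 - ?h (L \<union> y)))" (is "\<exists>c. \<forall>y\<subseteq>_. ?P c y")
    proof (cases "w \<in> reach (L \<union> x) A")
      case True
      have "?P (4 * max 0 (2 * z - 1)) y" for y
      proof -
        have "w \<in> reach (L \<union> y \<union> x) A" "w \<in> reach (L \<union> (x \<union> y)) (insert v A)"
          using True reach_mono[of "L \<union> x" "L \<union> y \<union> x" A A]
            reach_mono[of "L \<union> x" "L \<union> (x \<union> y)" A "insert v A"] by auto
        moreover have "0 \<le> 2 * (of_bool (w \<in> reach (L \<union> y) {v}) * (1 - ?h (L \<union> y)))"
          using late_hit_bounds(2)[of S w A "L \<union> y"] by simp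
        ultimately show ?thesis
          using weight_tangent(2)[of z "?h (L \<union> y)"] by simp
      qed
      then show ?thesis by blast
    next
      case False
      have "?P (4 * z) y" if y: "y \<subseteq> out {v}" for y
      proof -
        \<comment> \<open>As \<open>A\<close> misses \<open>w\<close> in
          \<open>L \<union> x\<close>, any hit comes from \<open>v\<close> within
          \<open>L \<union> y\<close>, the event charged to \<open>target_gain\<close>. The old flag
          may hold too, if \<open>A\<close> reaches \<open>v\<close>.\<close>
        have hit: "w \<in> reach (L \<union> (x \<union> y)) (insert v A) \<longleftrightarrow> w \<in> reach (L \<union> y) {v}"
          using reach_through_last_seed[of w L x y v A] x y False
            reach_mono[of "L \<union> y" "L \<union> (x \<union> y)" "{v}" "insert v A"]
          by (auto simp: out_edges_def)
        have "w \<in> reach (L \<union> y \<union> x) A \<Longrightarrow> w \<in> reach (L \<union> (x \<union> y)) (insert v A)"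
          using reach_mono[of "L \<union> y \<union> x" "L \<union> (x \<union> y)" A "insert v A"] by auto
        with hit show ?thesis
          using weight_hit[OF z late_hit_bounds[of S w A "L \<union> y"]]
            weight_tangent(1)[of z "?h (L \<union> y)"]
          by (cases "w \<in> reach (L \<union> y) {v}"; cases "w \<in> reach (L \<union> y \<union> x) A") auto
      qed
      then show ?thesis by blast
    qed
    then obtain c where c: "\<And>y. y \<subseteq> out {v} \<Longrightarrow> ?P c y" by blast
    have "live_expect (out {v}) p (\<lambda>y. c * (?h (L \<union> y) - z)) = 0"
      by (simp add: live_expect_cmult live_expect_diff live_expect_const z_def late_hit_insert[OF v])
    then have "live_expect (out {v}) p (\<lambda>y. weight (w \<in> reach (L \<union> (x \<union> y)) (insert v A)) z) =
      live_expect (out {v}) p (\<lambda>y. weight (w \<in> reach (L \<union> (x \<union> y)) (insert v A)) z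
        + c * (?h (L \<union> y) - z))"
      by (simp add: live_expect_add)
    also have "\<dots> \<le> live_expect (out {v}) p (\<lambda>y. weight (w \<in> reach (L \<union> y \<union> x) A) (?h (L \<union> y)) +
        2 * (of_bool (w \<in> reach (L \<union> y) {v}) * (1 - ?h (L \<union> y))))"
      by (intro live_expect_mono prob_out c)
    finally show ?thesis by (simp add: z_def)
  qed
  have "live_expect (out {v}) p (\<lambda>X. potential S w (insert v A) (x \<union> X))
      = live_expect ?F p (\<lambda>L. live_expect (out {v}) p (\<lambda>y.
          weight (w \<in> reach (L \<union> (x \<union> y)) (insert v A)) (late_hit S w (insert v A) L)))"
    unfolding potential_def by (rule live_expect_swap)
  also have "\<dots> \<le> live_expect ?F p (\<lambda>L. live_expect (out {v}) p (\<lambda>y.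
        weight (w \<in> reach (L \<union> y \<union> x) A) (?h (L \<union> y)) +
        2 * (of_bool (w \<in> reach (L \<union> y) {v}) * (1 - ?h (L \<union> y)))))"
    by (intro live_expect_mono prob_off key)
  also have "\<dots> = potential S w A x + 2 * live_expect (E - out A) p
      (\<lambda>L. of_bool (w \<in> reach L {v}) * (1 - ?h L))"
    unfolding potential_def live_expect_off[OF v] by (simp add: live_expect_add live_expect_cmult)
  also have "\<dots> \<le> potential S w A x + 2 * target_gain S w v"
    using target_gain_ge by (intro add_left_mono mult_left_mono) auto
  finally show ?thesis .
qed

end


section \<open>Adaptive policies\<close>

text \<open>Unlike \<open>run\<close>, this starts anywhere and peels off the first choice, so an
  induction can move the edges of that seed into the observed part.\<close>

fun run_from :: "policy \<Rightarrow> (nat \<times> nat) set \<Rightarrow> nat \<Rightarrow> partial_real \<Rightarrow> partial_real" where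
  "run_from \<pi> L 0 \<psi> = \<psi>"
| "run_from \<pi> L (Suc m) \<psi> = (case \<pi> \<psi> of
      None \<Rightarrow> \<psi>
    | Some v \<Rightarrow> run_from \<pi> L m (\<psi>(v \<mapsto> realisation L v)))"

lemma run_from_stopped: "\<pi> \<psi> = None \<Longrightarrow> run_from \<pi> L m \<psi> = \<psi>"
  by (cases m) auto

lemma run_from_Suc:
  "run_from \<pi> L (Suc m) \<psi> = (case \<pi> (run_from \<pi> L m \<psi>) of
      None \<Rightarrow> run_from \<pi> L m \<psi>
    | Some v \<Rightarrow> (run_from \<pi> L m \<psi>)(v \<mapsto> realisation L v))"
proof (induction m arbitrary: \<psi>)
  case (Suc m)
  show ?case
  proof (cases "\<pi> \<psi>")
    case (Some v)
    then have "run_from \<pi> L (Suc j) \<psi> = run_from \<pi> L j (\<psi>(v \<mapsto> realisation L v))" for j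
      by simp
    then show ?thesis using Suc.IH by presburger
  qed simp
qed (simp split: option.split)

lemma run_eq_run_from: "run \<pi> L m = run_from \<pi> L m Map.empty"
proof (induction m)
  case (Suc m)
  show ?case unfolding run.simps run_from_Suc Suc ..
qed simp

lemma dom_run_from: "dom \<psi> \<subseteq> dom (run_from \<pi> L m \<psi>)"
proof (induction m arbitrary: \<psi>)
  case (Suc m)
  show ?case
  proof (cases "\<pi> \<psi>")
    case (Some v)
    have "dom \<psi> \<subseteq> dom (\<psi>(v \<mapsto> realisation L v))" by auto
    also note Suc.IH
    finally show ?thesis unfolding run_from.simps Some option.case .
  qed simp
qed simp

text \<open>The starting domain may be infinite, but splitting a new seed off a sum over the later
  seeds requires these to be finitely many.\<close>

lemma finite_dom_run_from:
  "finite (dom (run_from \<pi> L m \<psi>) - dom \<psi>)"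
proof (induction m arbitrary: \<psi>)
  case (Suc m)
  show ?case
  proof (cases "\<pi> \<psi>")
    case (Some v)
    have "dom (run_from \<pi> L (Suc m) \<psi>) - dom \<psi> \<subseteq> insert v
        (dom (run_from \<pi> L m (\<psi>(v \<mapsto> realisation L v))) - dom (\<psi>(v \<mapsto> realisation L v)))"
      using Some by auto
    with Suc.IH show ?thesis by (meson finite_insert finite_subset)
  qed simp
qed simp

lemma run_eq_final:
  assumes "\<pi> (run \<pi> L m) = None" "m \<le> M"
  shows "run \<pi> L M = final \<pi> L"
proof -
  define l where "l = (LEAST m. \<pi> (run \<pi> L m) = None)"
  have l: "\<pi> (run \<pi> L l) = None" "l \<le> m"
    unfolding l_def using assms(1) by (rule LeastI, rule Least_le)
  have "run \<pi> L (l + d) = run \<pi> L l" for d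
    by (induction d) (use l in auto)
  then have "run \<pi> L M = run \<pi> L l"
    using l(2) assms(2) by (metis le_add_diff_inverse order_trans)
  then show ?thesis by (simp add: final_def l_def)
qed

text \<open>Encoding a partial realisation by its seeds \<open>A\<close> and their live out-edges
  \<open>x\<close> separates what is known from the still independent edges outside
  \<open>out A\<close>.\<close>

definition observation :: "nat set \<Rightarrow> (nat \<times> nat) set \<Rightarrow> partial_real" where
  "observation A x = (\<lambda>v. if v \<in> A then Some (realisation x v) else None)"

lemma dom_observation [simp]: "dom (observation A x) = A"
  by (auto simp: observation_def dom_def)

context cascade
begin

lemma observation_known:
  assumes "v \<in> A" "L \<subseteq> E - out A"
  shows "(observation A x)(v \<mapsto> realisation (L \<union> x) v) = observation A x"
proof -
  have "realisation (L \<union> x) v = realisation x v"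
    using assms by (auto simp: realisation_def out_edges_def)
  then show ?thesis using assms(1) by (auto simp: observation_def)
qed

lemma observation_new:
  assumes "v \<notin> A" "x \<subseteq> out A" "X \<subseteq> out {v}" "L \<subseteq> E - out (insert v A)"
  shows "(observation A x)(v \<mapsto> realisation (L \<union> (x \<union> X)) v) = observation (insert v A) (x \<union> X)"
proof -
  have "realisation (L \<union> (x \<union> X)) v = realisation (x \<union> X) v"
    using assms by (auto simp: realisation_def out_edges_def)
  moreover have "realisation (x \<union> X) u = realisation x u" if "u \<in> A" for u
    using assms that by (auto simp: realisation_def out_edges_def)
  ultimately show ?thesis by (auto simp: observation_def)
qed

text \<open>Induction on the steps left: \<open>weight_ge\<close> settles a stopped run,
  \<open>potential_step\<close> pays for each new seed, and only seeds outside \<open>A\<close>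
  remain to be charged.\<close>

lemma adaptive_target_bound_from:
  assumes "x \<subseteq> out A"
  shows "live_expect (E - out A) p (\<lambda>L. of_bool
        (w \<in> reach (L \<union> x) (dom (run_from \<pi> (L \<union> x) m (observation A x)))))
    \<le> potential S w A x + 2 * live_expect (E - out A) p (\<lambda>L.
        \<Sum>u\<in>dom (run_from \<pi> (L \<union> x) m (observation A x)) - A. target_gain S w u)"
  using assms
proof (induction m arbitrary: A x)
  case 0
  have "live_expect (E - out A) p (\<lambda>L. of_bool (w \<in> reach (L \<union> x) A)) \<le> potential S w A x"
    unfolding potential_def by (intro live_expect_mono prob_off weight_ge)
  then show ?case by (simp add: live_expect_const)
next
  case (Suc m)
  show ?case
  proof (cases "\<pi> (observation A x)")
    case None
    have "live_expect (E - out A) p (\<lambda>L. of_bool (w \<in> reach (L \<union> x) A)) \<le> potential S w A x"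
      unfolding potential_def by (intro live_expect_mono prob_off weight_ge)
    then show ?thesis using None by (simp add: live_expect_const)
  next
    case (Some v)
    show ?thesis
    proof (cases "v \<in> A")
      \<comment> \<open>A repeated choice reveals nothing and merely uses up a step.\<close>
      case True
      have "run_from \<pi> (L \<union> x) (Suc m) (observation A x) = run_from \<pi> (L \<union> x) m (observation A x)"
        if "L \<subseteq> E - out A" for L
        using Some observation_known[OF True that, of x] by simp
      then have "live_expect (E - out A) p (\<lambda>L. f L (run_from \<pi> (L \<union> x) (Suc m) (observation A x)))
          = live_expect (E - out A) p (\<lambda>L. f L (run_from \<pi> (L \<union> x) m (observation A x)))" for f
        by (intro live_expect_cong) metis
      note same = this[of "\<lambda>L \<psi>. of_bool (w \<in> reach (L \<union> x) (dom \<psi>))"]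
        this[of "\<lambda>_ \<psi>. \<Sum>u\<in>dom \<psi> - A. target_gain S w u"]
      show ?thesis unfolding same by (rule Suc.IH[OF Suc.prems])
    next
      case v: False
      let ?F = "E - out (insert v A)" and ?g = "target_gain S w"
      \<comment> \<open>The choice of \<open>v\<close> is determined by \<open>A\<close> and
        \<open>x\<close>, so its edges \<open>X\<close> are still unconditioned; later choices, and
        with them \<open>D\<close>, may depend on \<open>X\<close>.\<close>
      define D where "D L X = dom (run_from \<pi> (L \<union> (x \<union> X)) m (observation (insert v A) (x \<union> X)))"
        for L X
      have assoc: "L \<union> X \<union> x = L \<union> (x \<union> X)" for L X
        by blast
      have D: "dom (run_from \<pi> (L \<union> (x \<union> X)) (Suc m) (observation A x)) = D L X"
        if "L \<subseteq> ?F" "X \<subseteq> out {v}" for L X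
        using Some observation_new[OF v Suc.prems that(2,1)] by (simp add: D_def)
      have sum_D: "(\<Sum>u\<in>D L X - A. ?g u) = ?g v + (\<Sum>u\<in>D L X - insert v A. ?g u)" for L X
      proof -
        have "insert v A \<subseteq> D L X"
          unfolding D_def using dom_run_from[of "observation (insert v A) (x \<union> X)"] by simp
        then have "D L X - A = insert v (D L X - insert v A)"
          using v by blast
        moreover have "finite (D L X - insert v A)"
          unfolding D_def using finite_dom_run_from[of _ _ _ "observation (insert v A) (x \<union> X)"]
          by simp
        ultimately show ?thesis by (metis DiffE insertI1 sum.insert)
      qed
      have "live_expect (E - out A) p (\<lambda>L.
            \<Sum>u\<in>dom (run_from \<pi> (L \<union> x) (Suc m) (observation A x)) - A. ?g u)
          = live_expect ?F p (\<lambda>L. live_expect (out {v}) p (\<lambda>X. \<Sum>u\<in>D L X - A. ?g u))"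
        unfolding live_expect_off[OF v]
        by (intro live_expect_cong) (simp add: assoc D del: run_from.simps(2))
      also have "\<dots> = ?g v + live_expect ?F p (\<lambda>L. live_expect (out {v}) p
            (\<lambda>X. \<Sum>u\<in>D L X - insert v A. ?g u))"
        by (simp add: sum_D live_expect_add live_expect_const)
      finally have rest: "live_expect (E - out A) p (\<lambda>L.
            \<Sum>u\<in>dom (run_from \<pi> (L \<union> x) (Suc m) (observation A x)) - A. ?g u) = \<dots>" .
      have "live_expect (E - out A) p (\<lambda>L. of_bool
            (w \<in> reach (L \<union> x) (dom (run_from \<pi> (L \<union> x) (Suc m) (observation A x)))))
          = live_expect ?F p (\<lambda>L. live_expect (out {v}) p (\<lambda>X.
              of_bool (w \<in> reach (L \<union> (x \<union> X)) (D L X))))"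
        unfolding live_expect_off[OF v]
        by (intro live_expect_cong) (simp add: assoc D del: run_from.simps(2))
      also have "\<dots> = live_expect (out {v}) p (\<lambda>X. live_expect ?F p (\<lambda>L.
              of_bool (w \<in> reach (L \<union> (x \<union> X)) (D L X))))"
        by (rule live_expect_swap)
      also have "\<dots> \<le> live_expect (out {v}) p (\<lambda>X. potential S w (insert v A) (x \<union> X) +
          2 * live_expect ?F p (\<lambda>L. \<Sum>u\<in>D L X - insert v A. ?g u))"
      proof (intro live_expect_mono prob_out)
        fix X assume "X \<subseteq> out {v}"
        then have "x \<union> X \<subseteq> out (insert v A)"
          using Suc.prems by (auto simp: out_edges_def)
        from Suc.IH[OF this] show "live_expect ?F p (\<lambda>L. of_bool (w \<in> reach (L \<union> (x \<union> X)) (D L X)))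
            \<le> potential S w (insert v A) (x \<union> X) +
              2 * live_expect ?F p (\<lambda>L. \<Sum>u\<in>D L X - insert v A. ?g u)"
          by (simp add: D_def)
      qed
      also have "\<dots> = live_expect (out {v}) p (\<lambda>X. potential S w (insert v A) (x \<union> X)) +
          2 * live_expect ?F p (\<lambda>L. live_expect (out {v}) p (\<lambda>X. \<Sum>u\<in>D L X - insert v A. ?g u))"
        unfolding live_expect_add live_expect_cmult
        by (subst live_expect_swap) (rule refl)
      also have "\<dots> \<le> potential S w A x + 2 * (?g v +
          live_expect ?F p (\<lambda>L. live_expect (out {v}) p (\<lambda>X. \<Sum>u\<in>D L X - insert v A. ?g u)))"
        using potential_step[OF v Suc.prems, of S w] by simp
      finally show ?thesis unfolding rest .
    qed
  qed
qed

lemma adaptive_target_bound: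
  "live_expect E p (\<lambda>L. of_bool (w \<in> reach L (dom (run \<pi> L m))))
    \<le> 2 * live_expect E p (\<lambda>L. of_bool (w \<in> reach L S))
      + 2 * live_expect E p (\<lambda>L. \<Sum>u\<in>dom (run \<pi> L m). target_gain S w u)"
proof -
  have "observation {} {} = Map.empty" by (auto simp: observation_def)
  \<comment> \<open>Without seeds the flag is \<open>False\<close> and \<open>late_hit\<close> is an
    indicator, which equals its own square.\<close>
  moreover have "potential S w {} {} = 2 * live_expect E p (\<lambda>L. of_bool (w \<in> reach L S))"
  proof -
    have "late_hit S w {} L = of_bool (w \<in> reach L S)" for L
      by (simp add: late_hit_def live_expect_def live_prob_def)
    moreover have "reach L {} = {}" for L by (simp add: reach_def)
    ultimately have "potential S w {} {} = live_expect E p (\<lambda>L. 2 * of_bool (w \<in> reach L S))"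
      by (simp add: potential_def weight_def power2_eq_square flip: of_bool_conj)
    then show ?thesis by (simp only: live_expect_cmult)
  qed
  ultimately show ?thesis
    using adaptive_target_bound_from[of "{}" "{}" w \<pi> m S] by (simp add: run_eq_run_from)
qed

section \<open>From one target node to the spread\<close>

lemma sigma_as_target_sum:
  assumes "E \<subseteq> V \<times> V" "finite V" "L \<subseteq> E" "T \<subseteq> V"
  shows "real (sigma_L L T) = (\<Sum>w\<in>V. of_bool (w \<in> reach L T))"
proof -
  have "V \<inter> {w. w \<in> reach L T} = reach L T"
    using reach_subset_vertices[of L V T] assms by auto
  then show ?thesis using assms(2) by (simp add: sigma_L_def)
qed

text \<open>The gains \<open>target_gain S w u\<close> do not depend on the realisation. Summed over
  \<open>w\<close> they give the gain of \<open>u\<close> in \<open>sigma\<close>, so each of the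
  \<open>k\<close> seeds costs at most \<open>2 * \<Delta>\<close>, whichever the policy
  picks.\<close>

lemma adaptive_bound:
  assumes V: "E \<subseteq> V \<times> V" "finite V" and S: "S \<subseteq> V" and \<pi>: "policy_size V E \<pi> k"
    and gain: "\<And>u. u \<in> V \<Longrightarrow> sigma E p (insert u S) - sigma E p S \<le> \<Delta>"
  shows "sigma_pol E p \<pi> \<le> 2 * (sigma E p S + real k * \<Delta>)"
proof -
  have sigma: "sigma E p T = (\<Sum>w\<in>V. live_expect E p (\<lambda>L. of_bool (w \<in> reach L T)))"
    if "T \<subseteq> V" for T
    unfolding sigma_eq_live_expect live_expect_sum[symmetric]
    by (intro live_expect_cong sigma_as_target_sum V that)
  have sum_gain: "(\<Sum>w\<in>V. target_gain S w u) = sigma E p (insert u S) - sigma E p S"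
    if "u \<in> V" for u
    using that S by (simp add: target_gain_def live_expect_diff sum_subtractf sigma)
  have stop: "\<forall>L\<in>Pow E. \<exists>m. \<pi> (run \<pi> L m) = None"
    using \<pi> by (auto simp: policy_size_def stops_def)
  then obtain m where m: "\<And>L. L \<in> Pow E \<Longrightarrow> \<pi> (run \<pi> L (m L)) = None"
    by metis
  \<comment> \<open>Stopping times vary with \<open>L\<close>; as there are finitely many
    \<open>L\<close>, one horizon makes every run final.\<close>
  define M where "M = Max (m ` Pow E)"
  have "m L \<le> M" if "L \<subseteq> E" for L
    unfolding M_def using that finite_edges by (intro Max_ge) auto
  then have run: "run \<pi> L M = final \<pi> L" if "L \<subseteq> E" for L
    using that m by (intro run_eq_final[of \<pi> L "m L"]) auto
  have D: "dom (final \<pi> L) \<subseteq> V" "card (dom (final \<pi> L)) = k" if "L \<subseteq> E" for L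
    using \<pi> that by (auto simp: policy_size_def)
  have "sigma_pol E p \<pi> = live_expect E p (\<lambda>L. \<Sum>w\<in>V. of_bool (w \<in> reach L (dom (run \<pi> L M))))"
    unfolding sigma_pol_eq_live_expect
    by (intro live_expect_cong) (simp add: run sigma_as_target_sum[OF V _ D(1)])
  also have "\<dots> = (\<Sum>w\<in>V. live_expect E p (\<lambda>L. of_bool (w \<in> reach L (dom (run \<pi> L M)))))"
    by (rule live_expect_sum)
  also have "\<dots> \<le> (\<Sum>w\<in>V. 2 * live_expect E p (\<lambda>L. of_bool (w \<in> reach L S))
      + 2 * live_expect E p (\<lambda>L. \<Sum>u\<in>dom (run \<pi> L M). target_gain S w u))"
    by (intro sum_mono adaptive_target_bound)
  also have "\<dots> = 2 * sigma E p S +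
      2 * live_expect E p (\<lambda>L. \<Sum>w\<in>V. \<Sum>u\<in>dom (run \<pi> L M). target_gain S w u)"
    by (simp add: sum.distrib sigma[OF S] live_expect_sum flip: sum_distrib_left)
  also have "live_expect E p (\<lambda>L. \<Sum>w\<in>V. \<Sum>u\<in>dom (run \<pi> L M). target_gain S w u)
      \<le> live_expect E p (\<lambda>_. real k * \<Delta>)"
  proof (intro live_expect_mono prob_edges)
    fix L assume L: "L \<subseteq> E"
    have "(\<Sum>w\<in>V. \<Sum>u\<in>dom (run \<pi> L M). target_gain S w u)
        = (\<Sum>u\<in>dom (final \<pi> L). \<Sum>w\<in>V. target_gain S w u)"
      by (subst sum.swap) (simp add: run L)
    also have "\<dots> \<le> (\<Sum>u\<in>dom (final \<pi> L). \<Delta>)"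
      using D(1)[OF L] gain sum_gain by (intro sum_mono) (metis subsetD)
    finally show "(\<Sum>w\<in>V. \<Sum>u\<in>dom (run \<pi> L M). target_gain S w u) \<le> real k * \<Delta>"
      by (simp add: D(2)[OF L])
  qed
  finally show ?thesis
    by (simp add: live_expect_const[OF finite_edges])
qed

lemma sigma_nonneg: "0 \<le> sigma E p S"
  unfolding sigma_def using prob_edges by (intro sum_nonneg mult_nonneg_nonneg live_prob_nonneg) auto

lemma sigma_pol_nonneg: "0 \<le> sigma_pol E p \<pi>"
  unfolding sigma_pol_def using prob_edges
  by (intro sum_nonneg mult_nonneg_nonneg live_prob_nonneg) auto

lemma sigma_mono:
  assumes "E \<subseteq> V \<times> V" "finite V" "S \<subseteq> T" "T \<subseteq> V"
  shows "sigma E p S \<le> sigma E p T"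
  unfolding sigma_eq_live_expect
proof (intro live_expect_mono prob_edges)
  fix L assume "L \<subseteq> E"
  then have "finite (reach L T)"
    using reach_subset_vertices[of L V T] assms by (meson finite_subset order_trans)
  then show "real (sigma_L L S) \<le> real (sigma_L L T)"
    unfolding sigma_L_def using reach_mono[OF order_refl assms(3)] by (simp add: card_mono)
qed

end

text \<open>Seeding \<open>1, ..., k\<close> in turn works. This makes the supremum in
  \<open>OPT_A\<close> one over a nonempty set.\<close>

lemma policy_size_exists:
  assumes "k \<le> n"
  shows "\<exists>\<pi>. policy_size {1..n} E \<pi> k"
proof -
  define \<pi> :: policy where
    "\<pi> \<psi> = (if card (dom \<psi>) < k then Some (Suc (card (dom \<psi>))) else None)" for \<psi>
  have dom: "dom (run \<pi> L m) = {1..m}" if "m \<le> k" for L m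
    using that by (induction m) (auto simp: \<pi>_def)
  have "stops \<pi> L \<and> dom (final \<pi> L) = {1..k}" for L
  proof -
    have "\<pi> (run \<pi> L k) = None" by (simp add: \<pi>_def dom)
    then have "stops \<pi> L" "run \<pi> L k = final \<pi> L"
      by (auto simp: stops_def intro: run_eq_final)
    then show ?thesis using dom[of k L] by simp
  qed
  then show ?thesis using assms by (intro exI[of _ \<pi>]) (auto simp: policy_size_def)
qed

section \<open>Greedy recursion against half the adaptive optimum\<close>

theorem theorem5:
  fixes n k :: nat and E :: "(nat \<times> nat) set" and p :: "nat \<times> nat \<Rightarrow> real"
    and v :: "nat \<Rightarrow> nat"
  assumes "influence_graph n E p"
    and "2 \<le> k" and "k \<le> n"
    and "greedy_seq n E p k v"
  shows "sigma E p (v ` {1..k}) \<ge> 1/2 * (1 - (1 - 1 / real k) ^ k) * OPT_A n E p k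
       \<and> 1/2 * (1 - (1 - 1 / real k) ^ k) * OPT_A n E p k \<ge> 1/2 * (1 - 1 / exp 1) * OPT_A n E p k"
proof -
  have E: "E \<subseteq> {1..n} \<times> {1..n}" and p: "\<forall>e\<in>E. 0 \<le> p e \<and> p e \<le> 1"
    using assms(1) by (auto simp: influence_graph_def)
  interpret cascade E p
    using E p by unfold_locales (auto intro: finite_subset)
  define S where "S t = v ` {1..t}" for t
  define OPT where "OPT = OPT_A n E p k"
  define r where "r = 1 - 1 / real k"
  have r: "0 \<le> r" using assms(2) by (simp add: r_def)
  have S_Suc: "S (Suc t) = insert (v (Suc t)) (S t)" for t
    by (simp add: S_def atLeastAtMostSuc_conv)
  have S_lt: "v ` {1..<Suc t} = S t" for t
    by (simp add: S_def atLeastLessThanSuc_atLeastAtMost)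
  have greedy: "v (Suc t) \<in> {1..n}"
      "\<And>u. u \<in> {1..n} - S t \<Longrightarrow> sigma E p (insert u (S t)) \<le> sigma E p (S (Suc t))"
    if "t < k" for t
  proof -
    have "Suc t \<in> {1..k}" using that by simp
    with assms(4) show "v (Suc t) \<in> {1..n}"
      "\<And>u. u \<in> {1..n} - S t \<Longrightarrow> sigma E p (insert u (S t)) \<le> sigma E p (S (Suc t))"
      unfolding greedy_seq_def S_Suc by (metis DiffD1 S_lt)+
  qed
  have S_sub: "S t \<subseteq> {1..n}" if "t \<le> k" for t
    using that greedy(1) by (auto simp: S_def) (metis Suc_le_D Suc_le_lessD atLeastAtMost_iff order_trans)+
  have policy_le: "sigma_pol E p \<pi>
      \<le> 2 * (sigma E p (S t) + real k * (sigma E p (S (Suc t)) - sigma E p (S t)))"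
    if t: "t < k" and \<pi>: "policy_size {1..n} E \<pi> k" for t \<pi>
  proof -
    \<comment> \<open>Greedy compares only nodes outside \<open>S t\<close>; for nodes inside,
      monotonicity of \<open>sigma\<close> gives the bound.\<close>
    have "sigma E p (insert u (S t)) \<le> sigma E p (S (Suc t))" if "u \<in> {1..n}" for u
    proof (cases "u \<in> S t")
      case True
      then have "insert u (S t) \<subseteq> S (Suc t)" by (auto simp: S_Suc)
      then show ?thesis using t by (intro sigma_mono[OF E] S_sub) auto
    qed (use that greedy(2)[OF t] in auto)
    then show ?thesis
      using t by (intro adaptive_bound[OF E _ S_sub \<pi>]) simp_all
  qed
  have OPT_le: "OPT \<le> 2 * (sigma E p (S t) + real k * (sigma E p (S (Suc t)) - sigma E p (S t)))"
    if "t < k" for t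
    unfolding OPT_def OPT_A_def
    by (rule cSup_least) (use policy_size_exists[OF assms(3)] policy_le[OF that] in blast)+
  \<comment> \<open>By \<open>OPT_le\<close>, each greedy step gains at least \<open>1 / k\<close>
    of the gap to \<open>OPT / 2\<close>, which shrinks the gap by the factor
    \<open>r\<close>.\<close>
  have "OPT / 2 - sigma E p (S t) \<le> r ^ t * (OPT / 2)" if "t \<le> k" for t
    using that
  proof (induction t)
    case 0
    then show ?case using sigma_nonneg by simp
  next
    case (Suc t)
    have "OPT / 2 - sigma E p (S (Suc t)) \<le> r * (OPT / 2 - sigma E p (S t))"
      using OPT_le[of t] Suc.prems assms(2) by (simp add: r_def field_simps)
    also have "\<dots> \<le> r * (r ^ t * (OPT / 2))"
      using Suc r by (intro mult_left_mono) auto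
    finally show ?case by simp
  qed
  from this[of k] have bound: "1/2 * (1 - r ^ k) * OPT \<le> sigma E p (S k)"
    by (simp add: algebra_simps)
  \<comment> \<open>The sign is used to compare the two multiples of \<open>OPT\<close>. A lower
    bound on a real supremum requires a bounded set; \<open>policy_le\<close> at
    \<open>t = 0\<close> bounds all policies at once.\<close>
  have "0 \<le> OPT"
  proof -
    obtain \<pi> where \<pi>: "policy_size {1..n} E \<pi> k"
      using policy_size_exists[OF assms(3)] by blast
    have "bdd_above {sigma_pol E p \<pi> |\<pi>. policy_size {1..n} E \<pi> k}"
      using policy_le[of 0] assms(2) by (intro bdd_aboveI) auto
    then show ?thesis
      unfolding OPT_def OPT_A_def using \<pi> sigma_pol_nonneg
      by (intro cSup_upper2[of "sigma_pol E p \<pi>"]) auto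
  qed
  moreover have "r ^ k \<le> 1 / exp 1"
  proof -
    have "r \<le> exp (- (1 / real k))"
      using exp_ge_add_one_self[of "- (1 / real k)"] by (simp add: r_def)
    then have "r ^ k \<le> exp (- (1 / real k)) ^ k"
      using r by (rule power_mono)
    also have "\<dots> = exp (real k * - (1 / real k))"
      by (rule exp_of_nat_mult[symmetric])
    also have "\<dots> = 1 / exp 1"
      using assms(2) by (simp add: exp_minus')
    finally show ?thesis .
  qed
  ultimately have "1/2 * (1 - 1 / exp 1) * OPT \<le> 1/2 * (1 - r ^ k) * OPT"
    by (intro mult_right_mono mult_left_mono) auto
  with bound show ?thesis
    by (simp add: S_def OPT_def r_def)
qed

end
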